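(* Suppose the triple $(P,Q,R)$ satisfies the system associated to the generalised Chazy equation with parameter $k=3$: $$P'=\tfrac16(P^2-Q),\qquad Q'=\tfrac23(PQ-R),\qquad R'=PR+\tfrac13Q^2.$$ Then the following holds. (1) The triples $$\left(P+\frac{R}{Q},\;-Q-3\frac{R^2}{Q^2},\;R+3\frac{R^3}{Q^3}\right)$$ and $$\left(P-\nu,\;\frac{5}{4}Q+\frac{27}{4}\mu^2-3\nu^2,\;\frac{17}{8}R-3\nu^3+\frac{63}{16}Q\mu+\frac{243}{16}\mu^3\right)$$ both satisfy the same system (parameter $k=3$), where $\mu$ is a root of the quartic equation $$\mu^4+\frac{2}{9}Q\mu^2+\frac{8}{81}R\mu-\frac{Q^2}{243}=0,$$ and $\nu=-\frac{9}{8}\mu-\frac{1}{24\mu}Q$ is a solution to $$\nu^4+\frac{R}{Q}\nu^3-\frac{3}{64}Q^2-\frac{9}{64}\frac{R^2}{Q}=0.$$ (2) For the same $\mu$, the triple $$\left(P+\mu,\;\frac{4}{3}Q+4\mu^2,\;\frac{4}{3}R+2Q\mu+10\mu^3\right)$$ satisfies the system associated to the generalised Chazy equation with parameter $k=2$ (i.e. $p'=\frac16(p^2-q)$, $q'=\frac23(pq-r)$, $r'=pr+\frac18q^2$). (3) The triple $$\left(P-\frac{Q^2}{3R},\;-\frac{5}{3}Q-\frac{5}{9}\frac{Q^4}{R^2},\;-\frac{5}{3}\frac{Q^3}{R}-\frac{5}{3}R-\frac{10}{27}\frac{Q^6}{R^3}\right)$$ satisfies the system associated to the generalised Chazy equation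 with parameter $k=4$ (i.e. $p'=\frac16(p^2-q)$, $q'=\frac23(pq-r)$, $r'=pr+\frac45q^2$).
   Context: The first order system associated to the generalised Chazy equation with parameter $k$, for functions $P,Q,R$ of $x$ (with $'=d/dx$), is $$P'=\tfrac16(P^2-Q),\qquad Q'=\tfrac23(PQ-R),\qquad R'=PR+\frac{k^2}{36-k^2}Q^2;$$ a triple "satisfies the system with parameter $k$" if its first, second and third entries satisfy these equations in the roles of $P,Q,R$. Quantities introduced as roots of polynomial equations are differentiable functions of $x$ (branches) satisfying the defining relations identically in $x$, and all statements are understood where the displayed denominators are nonzero. *)

theory Defs
  imports "HOL-Analysis.Analysis"
begin

text \<open>
  The type \<^typ>\<open>'a\<close> ranges over real normed fields, so that both real differentiable
  (\<^typ>\<open>real\<close>) and holomorphic (\<^typ>\<open>complex\<close>) functions are covered.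
  The parameter is meant to satisfy \<open>k\<^sup>2 \<noteq> 36\<close>.
\<close>

definition chazy_system ::
  "'a::real_normed_field \<Rightarrow> 'a set \<Rightarrow> ('a \<Rightarrow> 'a) \<Rightarrow> ('a \<Rightarrow> 'a) \<Rightarrow> ('a \<Rightarrow> 'a) \<Rightarrow> bool"
where
  "chazy_system k S P Q R \<longleftrightarrow>
    (\<forall>x\<in>S.
      (P has_field_derivative (1/6) * ((P x)^2 - Q x)) (at x) \<and>
      (Q has_field_derivative (2/3) * (P x * Q x - R x)) (at x) \<and>
      (R has_field_derivative P x * R x + k^2 / (36 - k^2) * (Q x)^2) (at x))"

text \<open>A differentiable branch on \<open>U\<close> of the roots of the quartic for \<open>\<mu>\<close>; field
  differentiability means complex differentiability over \<^typ>\<open>complex\<close>.\<close>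

definition mu_branch ::
  "'a::real_normed_field set \<Rightarrow> ('a \<Rightarrow> 'a) \<Rightarrow> ('a \<Rightarrow> 'a) \<Rightarrow> ('a \<Rightarrow> 'a) \<Rightarrow> bool"
where
  "mu_branch U Q R \<mu> \<longleftrightarrow>
    (\<forall>x\<in>U. \<mu> field_differentiable (at x) \<and>
      (\<mu> x)^4 + (2/9) * Q x * (\<mu> x)^2 + (8/81) * R x * \<mu> x - (Q x)^2 / 243 = 0)"

end

theory Submission
  imports Defs
begin

text \<open>
  The idea is to attach to each transformation the quantity by which it shifts \<open>P\<close>, and to
  observe that this quantity satisfies a Riccati-type equation along the flow. For
  \<open>u = R / Q\<close> and \<open>v = Q\<^sup>2 / (3 R)\<close> these equations,
  \<open>u' = P u / 3 + Q / 3 + 2 u\<^sup>2 / 3\<close> and \<open>v' = P v / 3 - 4 Q / 9 - v\<^sup>2\<close>, follow from the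
  quotient rule; the new triples are polynomials in \<open>P\<close>, \<open>Q\<close>, \<open>R\<close> and the shift, and
  the three equations to be checked become polynomial identities.

  For the branches \<open>\<mu>\<close> the equation is \<open>\<mu>' = P \<mu> / 3 - \<mu>\<^sup>2 / 2 - Q / 18\<close>
  (lemma \<open>mu_branch_derivative\<close>). At a simple root of the quartic it is implicit
  differentiation. A branch may however consist entirely of multiple roots, and then implicit
  differentiation says nothing. The discriminant of the quartic is a multiple of the square of
  \<open>D = Q\<^sup>3 + 3 R\<^sup>2\<close>, and the flow gives \<open>D' = 2 P D\<close>, a linear equation. Hence if \<open>D\<close> vanishes at a
  point, it vanishes in a neighbourhood. There \<open>Q = - 27 \<sigma>\<^sup>2\<close> and \<open>R = 81 \<sigma>\<^sup>3\<close> for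
  \<open>\<sigma> = - R / (3 Q)\<close>, the quartic factors as \<open>(\<mu> - \<sigma>)\<^sup>3 (\<mu> + 3 \<sigma>)\<close>, and the branch
  equals the explicit function \<open>\<sigma>\<close>; if \<open>Q\<close> also vanishes at the point, then \<open>Q\<close>, \<open>R\<close> and
  \<open>\<mu>\<close> vanish around it.

  Given \<open>\<mu>'\<close>, the parameter 2 statement is a computation modulo the quartic. For the
  \<open>\<nu>\<close> statement, the definition of \<open>\<nu>\<close> and the quartic together express \<open>Q\<close> and \<open>R\<close> as
  polynomials in \<open>\<mu>\<close> and \<open>\<nu>\<close> (lemma \<open>mu_nu_parametrisation\<close>), and also
  \<open>\<nu>' = P \<nu> / 3 - \<mu> \<nu> - 2 \<nu>\<^sup>2 / 3\<close>, so that all that remains are polynomial identities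
  in \<open>P\<close>, \<open>\<mu>\<close>, \<open>\<nu>\<close>.
\<close>

section \<open>The Chazy flow with parameter 3\<close>

lemma chazy_systemD:
  assumes "chazy_system k S P Q R" "x \<in> S"
  shows "(P has_field_derivative (1/6) * ((P x)^2 - Q x)) (at x)"
    and "(Q has_field_derivative (2/3) * (P x * Q x - R x)) (at x)"
    and "(R has_field_derivative P x * R x + k^2 / (36 - k^2) * (Q x)^2) (at x)"
  using assms by (auto simp: chazy_system_def)

lemma chazy_system_3D:
  assumes "chazy_system 3 S P Q R" "x \<in> S"
  shows "(R has_field_derivative P x * R x + (Q x)^2 / 3) (at x)"
  using chazy_systemD(3)[OF assms] by (simp add: power2_eq_square)

lemma chazy_system_subset:
  assumes "chazy_system k S P Q R" "T \<subseteq> S"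
  shows "chazy_system k T P Q R"
  using assms by (auto simp: chazy_system_def)

section \<open>Transformations by rational functions of the solution\<close>

lemma ratio_derivative:
  fixes P Q R :: "'a::real_normed_field \<Rightarrow> 'a"
  assumes "chazy_system 3 S P Q R" "x \<in> S" "Q x \<noteq> 0"
  shows "((\<lambda>x. R x / Q x) has_field_derivative
           P x * (R x / Q x) / 3 + Q x / 3 + 2/3 * (R x / Q x)^2) (at x)"
  by (rule DERIV_cong[OF DERIV_divide[OF chazy_system_3D chazy_systemD(2)]], (fact assms)+)
    (use assms(3) in \<open>simp add: field_simps power2_eq_square\<close>)

lemma chazy_3_ratio_transformation:
  fixes P Q R :: "'a::real_normed_field \<Rightarrow> 'a"
  assumes sys: "chazy_system 3 S P Q R"
  shows "chazy_system 3 {x\<in>S. Q x \<noteq> 0}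
           (\<lambda>x. P x + R x / Q x)
           (\<lambda>x. - Q x - 3 * ((R x)^2 / (Q x)^2))
           (\<lambda>x. R x + 3 * ((R x)^3 / (Q x)^3))"
proof -
  define u where "u = (\<lambda>x. R x / Q x)"
  have "chazy_system 3 {x\<in>S. Q x \<noteq> 0}
          (\<lambda>x. P x + u x) (\<lambda>x. - Q x - 3 * (u x)^2) (\<lambda>x. R x + 3 * (u x)^3)"
    unfolding chazy_system_def
  proof (intro ballI)
    fix x assume "x \<in> {x\<in>S. Q x \<noteq> 0}"
    then have x: "x \<in> S" "Q x \<noteq> 0" by auto
    have du: "(u has_field_derivative P x * u x / 3 + Q x / 3 + 2/3 * (u x)^2) (at x)"
      unfolding u_def by (rule ratio_derivative[OF sys x])
    note [derivative_intros] = chazy_systemD(1,2)[OF sys x(1)] chazy_system_3D[OF sys x(1)] du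
    have R: "R x = u x * Q x" using x by (simp add: u_def)
    show "((\<lambda>x. P x + u x) has_field_derivative
            (1/6) * ((P x + u x)^2 - (- Q x - 3 * (u x)^2))) (at x) \<and>
          ((\<lambda>x. - Q x - 3 * (u x)^2) has_field_derivative
            (2/3) * ((P x + u x) * (- Q x - 3 * (u x)^2) - (R x + 3 * (u x)^3))) (at x) \<and>
          ((\<lambda>x. R x + 3 * (u x)^3) has_field_derivative
            (P x + u x) * (R x + 3 * (u x)^3) + 3^2 / (36 - 3^2) * (- Q x - 3 * (u x)^2)^2) (at x)"
      by (intro conjI; (rule derivative_eq_intros refl)+)
        (use x(2) in \<open>simp_all add: R field_simps power2_eq_square power3_eq_cube\<close>)
  qed
  then show ?thesis by (simp add: u_def power_divide)
qed

lemma Q_squared_over_3R_derivative: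
  fixes P Q R :: "'a::real_normed_field \<Rightarrow> 'a"
  assumes "chazy_system 3 S P Q R" "x \<in> S" "R x \<noteq> 0"
  defines "v \<equiv> \<lambda>x. (Q x)^2 / (3 * R x)"
  shows "(v has_field_derivative P x * v x / 3 - 4/9 * Q x - (v x)^2) (at x)"
  unfolding v_def
  by (rule derivative_eq_intros chazy_systemD(2)[OF assms(1,2)] chazy_system_3D[OF assms(1,2)] refl)+
    (use assms(3) in \<open>simp_all add: field_simps power2_eq_square\<close>)

lemma chazy_4_transformation:
  fixes P Q R :: "'a::real_normed_field \<Rightarrow> 'a"
  assumes sys: "chazy_system 3 S P Q R"
  shows "chazy_system 4 {x\<in>S. R x \<noteq> 0}
       (\<lambda>x. P x - (Q x)^2 / (3 * R x))
       (\<lambda>x. - (5/3) * Q x - (5/9) * ((Q x)^4 / (R x)^2))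
       (\<lambda>x. - (5/3) * ((Q x)^3 / R x) - (5/3) * R x - (10/27) * ((Q x)^6 / (R x)^3))"
    (is "chazy_system 4 _ ?p ?q ?r")
proof -
  define v where "v = (\<lambda>x. (Q x)^2 / (3 * R x))"
  have "chazy_system 4 {x\<in>S. R x \<noteq> 0}
          (\<lambda>x. P x - v x) (\<lambda>x. - (5/3) * Q x - 5 * (v x)^2)
          (\<lambda>x. - 5 * Q x * v x - (5/3) * R x - 10 * (v x)^3)"
    unfolding chazy_system_def
  proof (intro ballI)
    fix x assume "x \<in> {x\<in>S. R x \<noteq> 0}"
    then have x: "x \<in> S" "R x \<noteq> 0" by auto
    have dv: "(v has_field_derivative P x * v x / 3 - 4/9 * Q x - (v x)^2) (at x)"
      unfolding v_def by (rule Q_squared_over_3R_derivative[OF sys x])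
    note [derivative_intros] = chazy_systemD(1,2)[OF sys x(1)] chazy_system_3D[OF sys x(1)] dv
    have Q2: "Q x * Q x = 3 * R x * v x" using x by (simp add: v_def power2_eq_square)
    have k: "(4::'a)^2 / (36 - 4^2) = 4/5" by (simp add: power2_eq_square)
    show "((\<lambda>x. P x - v x) has_field_derivative
            (1/6) * ((P x - v x)^2 - (- (5/3) * Q x - 5 * (v x)^2))) (at x) \<and>
          ((\<lambda>x. - (5/3) * Q x - 5 * (v x)^2) has_field_derivative
            (2/3) * ((P x - v x) * (- (5/3) * Q x - 5 * (v x)^2)
              - (- 5 * Q x * v x - (5/3) * R x - 10 * (v x)^3))) (at x) \<and>
          ((\<lambda>x. - 5 * Q x * v x - (5/3) * R x - 10 * (v x)^3) has_field_derivative
            (P x - v x) * (- 5 * Q x * v x - (5/3) * R x - 10 * (v x)^3)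
              + 4^2 / (36 - 4^2) * (- (5/3) * Q x - 5 * (v x)^2)^2) (at x)"
      unfolding k
      apply (intro conjI; (rule derivative_eq_intros refl)+)
        apply (simp_all add: field_simps power2_eq_square power3_eq_cube)
      \<comment> \<open>The third equation holds only modulo \<open>Q\<^sup>2 = 3 R v\<close>.\<close>
      using Q2 apply algebra
      done
  qed
  \<comment> \<open>The formulas agree at zeros of \<open>R\<close> too, where every quotient has the value \<open>0\<close>.\<close>
  moreover have "?p x = P x - v x \<and> ?q x = - (5/3) * Q x - 5 * (v x)^2
      \<and> ?r x = - 5 * Q x * v x - (5/3) * R x - 10 * (v x)^3" for x
    by (cases "R x = 0") (simp_all add: v_def field_simps eval_nat_numeral)
  ultimately show ?thesis by presburger
qed

section \<open>Branches of the quartic\<close>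

lemma locally_bounded_if_isCont:
  fixes f :: "'a::t2_space \<Rightarrow> 'b::real_normed_vector"
  assumes "isCont f a"
  shows "\<forall>\<^sub>F x in nhds a. norm (f x) < norm (f a) + 1"
proof -
  have "((\<lambda>x. norm (f x)) \<longlongrightarrow> norm (f a)) (nhds a)"
    using assms by (intro tendsto_norm) (simp add: continuous_at tendsto_at_iff_tendsto_nhds)
  then show ?thesis by (rule order_tendstoD) simp
qed

lemma eventually_nonzero_if_isCont:
  fixes f :: "'a::t2_space \<Rightarrow> 'b::{t1_space, zero}"
  assumes "isCont f a" "f a \<noteq> 0"
  shows "\<forall>\<^sub>F x in nhds a. f x \<noteq> 0"
  using assms
  by (intro tendsto_imp_eventually_ne[where c = "f a"])
    (auto simp: continuous_at tendsto_at_iff_tendsto_nhds)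

text \<open>
  A Gronwall argument. On a ball of radius \<open>r\<close> with \<open>K r \<le> 1/2\<close>, a bound \<open>B\<close> for \<open>f\<close>
  bounds \<open>f'\<close> by \<open>K B\<close>; as \<open>f a = 0\<close>, the mean value inequality improves the bound to
  \<open>K B r \<le> B / 2\<close>. Iterating gives \<open>f = 0\<close> on the ball.
\<close>

lemma eventually_zero_if_derivative_linearly_bounded:
  fixes f f' :: "'a::real_normed_field \<Rightarrow> 'a"
  assumes f: "\<forall>\<^sub>F x in nhds a. (f has_field_derivative f' x) (at x) \<and> norm (f' x) \<le> K * norm (f x)"
    and a: "f a = 0"
  shows "\<forall>\<^sub>F x in nhds a. f x = 0"
proof -
  have "isCont f a"
    using eventually_nhds_x_imp_x[OF f] DERIV_isCont by blast
  then have "\<forall>\<^sub>F x in nhds a. norm (f x) < 1"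
    using locally_bounded_if_isCont a by fastforce
  with f have "\<forall>\<^sub>F x in nhds a. (f has_field_derivative f' x) (at x) \<and>
                 norm (f' x) \<le> K * norm (f x) \<and> norm (f x) < 1"
    by eventually_elim auto
  then obtain d where d: "d > 0" and *: "\<And>x. dist x a < d \<Longrightarrow>
      (f has_field_derivative f' x) (at x) \<and> norm (f' x) \<le> K * norm (f x) \<and> norm (f x) < 1"
    by (auto simp: eventually_nhds_metric)
  define C where "C = max K 0"
  define r where "r = min d (1 / (2 * (C + 1)))"
  have C: "C \<ge> 0" "K \<le> C" by (auto simp: C_def)
  have r: "r > 0" "r \<le> d" using d C by (auto simp: r_def)
  have "C * r \<le> C * (1 / (2 * (C + 1)))" using C by (intro mult_left_mono) (auto simp: r_def)
  also have "\<dots> \<le> 1/2" using C by (simp add: field_simps)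
  finally have Cr: "C * r \<le> 1/2" .
  have bound: "norm (f x) \<le> (1/2)^n" if "x \<in> ball a r" for x n
    using that
  proof (induction n arbitrary: x)
    case 0
    then show ?case using *[of x] r by (auto simp: dist_commute)
  next
    case (Suc n)
    have "norm (f x - f a) \<le> C * (1/2)^n * norm (x - a)"
    proof (rule field_differentiable_bound[OF convex_ball])
      fix z assume z: "z \<in> ball a r"
      then have z': "(f has_field_derivative f' z) (at z)" "norm (f' z) \<le> K * norm (f z)"
        using *[of z] r by (auto simp: dist_commute)
      show "(f has_field_derivative f' z) (at z within ball a r)"
        using z'(1) by (rule has_field_derivative_at_within)
      have "K * norm (f z) \<le> C * (1/2)^n"
        using C Suc.IH[OF z] by (intro mult_mono) auto
      with z'(2) show "norm (f' z) \<le> C * (1/2)^n" by linarith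
    qed (use Suc.prems r in auto)
    also have "\<dots> \<le> C * (1/2)^n * r"
      using C Suc.prems by (intro mult_left_mono) (auto simp: dist_norm norm_minus_commute)
    also have "\<dots> = (C * r) * (1/2)^n" by simp
    also have "\<dots> \<le> 1/2 * (1/2)^n" by (intro mult_right_mono Cr) simp
    finally show ?case using a by simp
  qed
  have "f x = 0" if "x \<in> ball a r" for x
  proof -
    have "(\<lambda>n. (1/2::real)^n) \<longlonglongrightarrow> 0" by (rule LIMSEQ_realpow_zero) auto
    then have "norm (f x) \<le> 0" by (rule LIMSEQ_le_const) (use bound[OF that] in auto)
    then show ?thesis by simp
  qed
  then show ?thesis using r by (auto simp: eventually_nhds_metric dist_commute)
qed

lemma discriminant_derivative:
  fixes P Q R :: "'a::real_normed_field \<Rightarrow> 'a"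
  assumes sys: "chazy_system 3 S P Q R" and x: "x \<in> S"
  shows "((\<lambda>x. (Q x)^3 + 3 * (R x)^2) has_field_derivative
           2 * P x * ((Q x)^3 + 3 * (R x)^2)) (at x)"
  by (rule derivative_eq_intros chazy_systemD(2)[OF sys x] chazy_system_3D[OF sys x] refl)+
    (simp add: field_simps power2_eq_square power3_eq_cube)

lemma discriminant_eventually_zero:
  fixes P Q R :: "'a::real_normed_field \<Rightarrow> 'a"
  assumes sys: "chazy_system 3 S P Q R" and S: "open S" "a \<in> S"
    and a: "(Q a)^3 + 3 * (R a)^2 = 0"
  shows "\<forall>\<^sub>F x in nhds a. (Q x)^3 + 3 * (R x)^2 = 0"
proof (rule eventually_zero_if_derivative_linearly_bounded)
  have "isCont P a" using DERIV_isCont chazy_systemD(1)[OF sys S(2)] by blast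
  from locally_bounded_if_isCont[OF this] eventually_nhds_in_open[OF S]
  show "\<forall>\<^sub>F x in nhds a.
      ((\<lambda>x. (Q x)^3 + 3 * (R x)^2) has_field_derivative 2 * P x * ((Q x)^3 + 3 * (R x)^2)) (at x) \<and>
      norm (2 * P x * ((Q x)^3 + 3 * (R x)^2))
        \<le> (2 * (norm (P a) + 1)) * norm ((Q x)^3 + 3 * (R x)^2)"
  proof eventually_elim
    case (elim x)
    have "norm (2 * P x) \<le> 2 * (norm (P a) + 1)" using elim(1) by (simp add: norm_mult)
    then have "norm (2 * P x * ((Q x)^3 + 3 * (R x)^2))
        \<le> (2 * (norm (P a) + 1)) * norm ((Q x)^3 + 3 * (R x)^2)"
      by (subst norm_mult) (intro mult_right_mono; simp)
    then show ?case using discriminant_derivative[OF sys elim(2)] by blast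
  qed
qed (fact a)

text \<open>
  The equation \<open>Q' = 2/3 (P Q - R)\<close> involves \<open>R\<close>, but the discriminant vanishes around \<open>a\<close>, so
  that \<open>3 |R|\<^sup>2 = |Q|\<^sup>3\<close> there. As soon as \<open>|Q| \<le> 1\<close> this gives \<open>|R| \<le> |Q|\<close>, and the equation
  is a linear bound on \<open>Q'\<close> in terms of \<open>Q\<close> alone.
\<close>

lemma Q_eventually_zero:
  fixes P Q R :: "'a::real_normed_field \<Rightarrow> 'a"
  assumes sys: "chazy_system 3 S P Q R" and S: "open S" "a \<in> S"
    and a: "Q a = 0" "R a = 0"
  shows "\<forall>\<^sub>F x in nhds a. Q x = 0"
proof (rule eventually_zero_if_derivative_linearly_bounded)
  have D: "\<forall>\<^sub>F x in nhds a. (Q x)^3 + 3 * (R x)^2 = 0"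
    by (rule discriminant_eventually_zero[OF sys S]) (simp add: a)
  have "isCont P a" "isCont Q a"
    using DERIV_isCont chazy_systemD(1,2)[OF sys S(2)] by blast+
  from locally_bounded_if_isCont[OF this(1)] locally_bounded_if_isCont[OF this(2)]
    eventually_nhds_in_open[OF S] D
  show "\<forall>\<^sub>F x in nhds a. (Q has_field_derivative (2/3) * (P x * Q x - R x)) (at x) \<and>
      norm ((2/3) * (P x * Q x - R x)) \<le> (norm (P a) + 2) * norm (Q x)"
  proof eventually_elim
    case (elim x)
    have "(Q x)^3 = - 3 * (R x)^2" using elim(4) a by (simp add: eq_neg_iff_add_eq_0)
    then have "norm ((Q x)^3) = norm (- 3 * (R x)^2)" by simp
    then have RQ: "3 * norm (R x)^2 = norm (Q x)^3"
      by (simp add: norm_mult norm_power)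
    have "norm (Q x)^3 \<le> 1 * norm (Q x)^2"
      unfolding power3_eq_cube power2_eq_square mult.assoc[symmetric]
      using elim(2) a by (intro mult_right_mono) (auto simp: mult_left_le_one_le)
    then have "norm (R x)^2 \<le> norm (Q x)^2" using RQ zero_le_power2[of "norm (R x)"] by linarith
    then have R: "norm (R x) \<le> norm (Q x)" by (rule power2_le_imp_le) simp
    have "norm ((2/3) * (P x * Q x - R x)) = 2/3 * norm (P x * Q x - R x)"
      by (subst norm_mult) (simp add: norm_divide)
    also have "\<dots> \<le> norm (P x * Q x - R x)" by simp
    also have "\<dots> \<le> norm (P x) * norm (Q x) + norm (R x)"
      by (metis norm_mult norm_triangle_ineq4)
    also have "\<dots> \<le> (norm (P a) + 1) * norm (Q x) + norm (Q x)"
      using elim(1) R by (intro add_mono mult_right_mono) auto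
    also have "\<dots> = (norm (P a) + 2) * norm (Q x)" by (simp add: algebra_simps)
    finally show ?case using chazy_systemD(2)[OF sys elim(3)] by blast
  qed
qed (fact a)

text \<open>
  Solving the vanishing of the derivative of the quartic for \<open>r\<close> and substituting
  turns the quartic into \<open>- (q + 27 m\<^sup>2)\<^sup>2 / 243\<close>.
\<close>

lemma quartic_multiple_root:
  fixes q r m :: "'a::field_char_0"
  assumes F: "m^4 + (2/9) * q * m^2 + (8/81) * r * m - q^2 / 243 = 0"
    and F': "4 * m^3 + (4/9) * q * m + (8/81) * r = 0"
  shows "q = - 27 * m^2" "r = 81 * m^3"
proof -
  have r: "r = - (81/8) * (4 * m^3 + (4/9) * q * m)"
    using F' by (simp add: field_simps) algebra
  have "(q + 27 * m^2)^2 = - 243 * (m^4 + (2/9) * q * m^2 + (8/81) * r * m - q^2 / 243)"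
    unfolding r by (simp add: field_simps eval_nat_numeral)
  then have "q + 27 * m^2 = 0" unfolding F by simp
  then show q: "q = - 27 * m^2" by (simp add: eq_neg_iff_add_eq_0)
  show "r = 81 * m^3"
    unfolding r q by (simp add: field_simps eval_nat_numeral)
qed

text \<open>
  The curve \<open>q\<^sup>3 + 3 r\<^sup>2 = 0\<close> is parametrised by \<open>(q, r) = (- 27 s\<^sup>2, 81 s\<^sup>3)\<close>, so the quartic has a
  triple root there, and a rational function of \<open>q\<close> and \<open>r\<close> gives this root.
\<close>

lemma quartic_factorisation:
  fixes q r m :: "'a::field_char_0"
  assumes D: "q^3 + 3 * r^2 = 0" and q: "q \<noteq> 0"
  defines "s \<equiv> - r / (3 * q)"
  shows "m^4 + (2/9) * q * m^2 + (8/81) * r * m - q^2 / 243 = (m - s)^3 * (m + 3 * s)"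
proof -
  have r: "r = - 3 * q * s" using q by (simp add: s_def)
  have "q^2 * (q + 27 * s^2) = 0" using D unfolding r by (simp add: algebra_simps eval_nat_numeral)
  then have q': "q = - 27 * s^2" using q by (simp add: eq_neg_iff_add_eq_0)
  show ?thesis unfolding r unfolding q' by (simp add: field_simps eval_nat_numeral)
qed

text \<open>
  Implicit differentiation. The candidate for \<open>\<mu>'\<close> need only be verified: \<open>e\<close> is the difference of
  the two derivatives, and differentiating the quartic along the flow shows that its product with
  the derivative of the quartic is zero.
\<close>

lemma mu_branch_derivative_simple_root:
  fixes P Q R :: "'a::real_normed_field \<Rightarrow> 'a"
  assumes sys: "chazy_system 3 S P Q R" and U: "open U" "U \<subseteq> S" and mu: "mu_branch U Q R \<mu>"
    and x: "x \<in> U" and simple: "4 * (\<mu> x)^3 + (4/9) * Q x * \<mu> x + (8/81) * R x \<noteq> 0"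
  shows "(\<mu> has_field_derivative P x * \<mu> x / 3 - (\<mu> x)^2 / 2 - Q x / 18) (at x)"
proof -
  let ?F = "\<lambda>x. 243 * (\<mu> x)^4 + 54 * Q x * (\<mu> x)^2 + 24 * R x * \<mu> x - (Q x)^2"
  let ?F' = "4 * (\<mu> x)^3 + (4/9) * Q x * \<mu> x + (8/81) * R x"
  have F0: "?F y = 0" if "y \<in> U" for y
  proof -
    have "(\<mu> y)^4 + (2/9) * Q y * (\<mu> y)^2 + (8/81) * R y * \<mu> y - (Q y)^2 / 243 = 0"
      using mu that by (auto simp: mu_branch_def)
    moreover have "?F y = 243 *
        ((\<mu> y)^4 + (2/9) * Q y * (\<mu> y)^2 + (8/81) * R y * \<mu> y - (Q y)^2 / 243)"
      by (simp add: algebra_simps)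
    ultimately show ?thesis by (simp only: mult_zero_right)
  qed
  have xS: "x \<in> S" using x U by auto
  obtain m' where m': "(\<mu> has_field_derivative m') (at x)"
    using mu x by (auto simp: mu_branch_def field_differentiable_def)
  note [derivative_intros] = m' chazy_systemD(2)[OF sys xS] chazy_system_3D[OF sys xS]
  define e where "e = m' - (P x * \<mu> x / 3 - (\<mu> x)^2 / 2 - Q x / 18)"
  have m'_eq: "m' = e + (P x * \<mu> x / 3 - (\<mu> x)^2 / 2 - Q x / 18)" by (simp add: e_def)
  \<comment> \<open>The second summand vanishes on the quartic: the expected \<open>\<mu>'\<close> makes the vector field
    tangent to it.\<close>
  have "(?F has_field_derivative 243 * ?F' * e + (4/3 * P x - 2 * \<mu> x) * ?F x) (at x)"
    by (rule derivative_eq_intros refl)+ (simp add: m'_eq field_simps eval_nat_numeral)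
  moreover have "(?F has_field_derivative 0) (at x)"
    by (rule has_field_derivative_transform_within_open[OF DERIV_const U(1) x])
      (use F0 in auto)
  ultimately have "243 * ?F' * e + (4/3 * P x - 2 * \<mu> x) * ?F x = 0" by (rule DERIV_unique)
  then have "243 * ?F' * e = 0" unfolding F0[OF x] mult_zero_right add_0_right .
  with simple have "e = 0" by (metis mult_eq_0_iff zero_neq_numeral)
  then show ?thesis using m' by (simp add: m'_eq)
qed

text \<open>
  At a multiple root the discriminant vanishes, hence it vanishes around \<open>x\<close>. If \<open>\<mu> x \<noteq> 0\<close>, the
  roots \<open>\<sigma>\<close> and \<open>- 3 \<sigma>\<close> of the quartic stay apart near \<open>x\<close>, and by continuity \<open>\<mu>\<close> follows \<open>\<sigma>\<close>. If
  \<open>\<mu> x = 0\<close>, these roots collide, but then \<open>Q\<close> and \<open>R\<close> vanish around \<open>x\<close> and the quartic reduces to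
  \<open>\<mu>\<^sup>4 = 0\<close>.
\<close>

lemma mu_branch_derivative_multiple_root:
  fixes P Q R :: "'a::real_normed_field \<Rightarrow> 'a"
  assumes sys: "chazy_system 3 S P Q R" and U: "open U" "U \<subseteq> S" and mu: "mu_branch U Q R \<mu>"
    and x: "x \<in> U" and Qx: "Q x = - 27 * (\<mu> x)^2" and Rx: "R x = 81 * (\<mu> x)^3"
  shows "(\<mu> has_field_derivative P x * \<mu> x / 3 - (\<mu> x)^2 / 2 - Q x / 18) (at x)"
proof -
  have xS: "x \<in> S" using x U by auto
  note sysU = chazy_system_subset[OF sys U(2)]
  have F0: "\<forall>\<^sub>F y in nhds x.
      (\<mu> y)^4 + (2/9) * Q y * (\<mu> y)^2 + (8/81) * R y * \<mu> y - (Q y)^2 / 243 = 0"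
    using eventually_nhds_in_open[OF U(1) x]
    by eventually_elim (use mu in \<open>auto simp: mu_branch_def\<close>)
  have D0: "\<forall>\<^sub>F y in nhds x. (Q y)^3 + 3 * (R y)^2 = 0"
    by (rule discriminant_eventually_zero[OF sysU U(1) x])
      (simp add: Qx Rx power_mult_distrib flip: power_mult)
  show ?thesis
  proof (cases "\<mu> x = 0")
    case True
    have "\<forall>\<^sub>F y in nhds x. Q y = 0"
      by (rule Q_eventually_zero[OF sysU U(1) x]) (simp_all add: Qx Rx True)
    with F0 D0 have "\<forall>\<^sub>F y in nhds x. \<mu> y = 0"
      by eventually_elim simp
    then have "(\<mu> has_field_derivative 0) (at x)"
      by (subst DERIV_cong_ev[OF refl _ refl]) auto
    then show ?thesis by (simp add: True Qx)
  next
    case False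
    define \<sigma> where "\<sigma> = (\<lambda>y. - R y / (3 * Q y))"
    have Q0: "Q x \<noteq> 0" using False by (simp add: Qx)
    have \<sigma>x: "\<sigma> x = \<mu> x" using False by (simp add: \<sigma>_def Qx Rx field_simps eval_nat_numeral)
    note dQ = chazy_systemD(2)[OF sys xS] and dR = chazy_system_3D[OF sys xS]
    have d\<sigma>: "(\<sigma> has_field_derivative P x * \<mu> x / 3 - (\<mu> x)^2 / 2 - Q x / 18) (at x)"
      unfolding \<sigma>_def
      by (rule derivative_eq_intros dQ dR refl)+
        (use False in \<open>simp_all add: Qx Rx field_simps eval_nat_numeral\<close>)
    have "isCont \<mu> x"
      using mu x by (auto simp: mu_branch_def intro: field_differentiable_imp_continuous_at)
    then have "isCont (\<lambda>y. \<mu> y + 3 * \<sigma> y) x"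
      using DERIV_isCont[OF d\<sigma>] by (intro continuous_intros)
    moreover have "\<mu> x + 3 * \<sigma> x \<noteq> 0" using False by (simp add: \<sigma>x)
    ultimately have "\<forall>\<^sub>F y in nhds x. Q y \<noteq> 0" "\<forall>\<^sub>F y in nhds x. \<mu> y + 3 * \<sigma> y \<noteq> 0"
      using eventually_nonzero_if_isCont DERIV_isCont[OF dQ] Q0 by blast+
    with F0 D0 have "\<forall>\<^sub>F y in nhds x. \<mu> y = \<sigma> y"
    proof eventually_elim
      case (elim y)
      have "(\<mu> y - \<sigma> y)^3 * (\<mu> y + 3 * \<sigma> y) = 0"
        using quartic_factorisation[OF elim(2,3), of "\<mu> y"] elim(1) by (simp only: \<sigma>_def)
      then show ?case using elim(4) by simp
    qed
    then show ?thesis using d\<sigma> by (subst DERIV_cong_ev[OF refl _ refl])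
  qed
qed

lemma mu_branch_derivative:
  fixes P Q R :: "'a::real_normed_field \<Rightarrow> 'a"
  assumes sys: "chazy_system 3 S P Q R" and U: "open U" "U \<subseteq> S" and mu: "mu_branch U Q R \<mu>"
    and x: "x \<in> U"
  shows "(\<mu> has_field_derivative P x * \<mu> x / 3 - (\<mu> x)^2 / 2 - Q x / 18) (at x)"
proof (cases "4 * (\<mu> x)^3 + (4/9) * Q x * \<mu> x + (8/81) * R x = 0")
  case True
  have "(\<mu> x)^4 + (2/9) * Q x * (\<mu> x)^2 + (8/81) * R x * \<mu> x - (Q x)^2 / 243 = 0"
    using mu x by (auto simp: mu_branch_def)
  from quartic_multiple_root[OF this True] show ?thesis
    by (rule mu_branch_derivative_multiple_root[OF assms])
next
  case False
  then show ?thesis by (rule mu_branch_derivative_simple_root[OF assms])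
qed

section \<open>Transformations by roots of the quartic\<close>

lemma chazy_2_transformation:
  fixes P Q R :: "'a::real_normed_field \<Rightarrow> 'a"
  assumes sys: "chazy_system 3 S P Q R" and U: "open U" "U \<subseteq> S" and mu: "mu_branch U Q R \<mu>"
  shows "chazy_system 2 U
         (\<lambda>x. P x + \<mu> x)
         (\<lambda>x. (4/3) * Q x + 4 * (\<mu> x)^2)
         (\<lambda>x. (4/3) * R x + 2 * Q x * \<mu> x + 10 * (\<mu> x)^3)"
  unfolding chazy_system_def
proof (intro ballI)
  fix x assume x: "x \<in> U"
  then have xS: "x \<in> S" using U by auto
  note [derivative_intros] = chazy_systemD(1,2)[OF sys xS] chazy_system_3D[OF sys xS]
    mu_branch_derivative[OF assms x]
  have F: "(\<mu> x)^4 + (2/9) * Q x * (\<mu> x)^2 + (8/81) * R x * \<mu> x - (Q x)^2 / 243 = 0"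
    using mu x by (auto simp: mu_branch_def)
  have k: "(2::'a)^2 / (36 - 2^2) = 1/8" by (simp add: power2_eq_square)
  show "((\<lambda>x. P x + \<mu> x) has_field_derivative
          (1/6) * ((P x + \<mu> x)^2 - ((4/3) * Q x + 4 * (\<mu> x)^2))) (at x) \<and>
        ((\<lambda>x. (4/3) * Q x + 4 * (\<mu> x)^2) has_field_derivative
          (2/3) * ((P x + \<mu> x) * ((4/3) * Q x + 4 * (\<mu> x)^2)
            - ((4/3) * R x + 2 * Q x * \<mu> x + 10 * (\<mu> x)^3))) (at x) \<and>
        ((\<lambda>x. (4/3) * R x + 2 * Q x * \<mu> x + 10 * (\<mu> x)^3) has_field_derivative
          (P x + \<mu> x) * ((4/3) * R x + 2 * Q x * \<mu> x + 10 * (\<mu> x)^3)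
            + 2^2 / (36 - 2^2) * ((4/3) * Q x + 4 * (\<mu> x)^2)^2) (at x)"
    unfolding k
    apply (intro conjI; (rule derivative_eq_intros refl)+)
      apply (simp_all add: field_simps eval_nat_numeral)
    \<comment> \<open>The first two equations hold identically, the third one only modulo the quartic.\<close>
    using F apply (simp add: field_simps eval_nat_numeral) apply algebra
    done
qed

text \<open>
  The quartic is linear in \<open>r\<close>, and the definition of \<open>n\<close> is linear in \<open>q\<close>, so both can be solved. That
  the solutions are polynomials in \<open>m\<close> and \<open>n\<close> makes these the right coordinates for the
  computations with \<open>\<nu>\<close>.
\<close>

lemma mu_nu_parametrisation:
  fixes q r m :: "'a::field_char_0"
  assumes F: "m^4 + (2/9) * q * m^2 + (8/81) * r * m - q^2 / 243 = 0" and m: "m \<noteq> 0"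
  defines "n \<equiv> - (9/8) * m - 1 / (24 * m) * q"
  shows "q = - 24 * m * n - 27 * m^2" "r = 81 * m^3 + 108 * m^2 * n + 24 * m * n^2"
proof -
  show q: "q = - 24 * m * n - 27 * m^2"
    using m by (simp add: n_def field_simps power2_eq_square)
  have "(8/81) * m * (r - (81 * m^3 + 108 * m^2 * n + 24 * m * n^2)) =
      m^4 + (2/9) * q * m^2 + (8/81) * r * m - q^2 / 243"
    unfolding q by (simp add: field_simps eval_nat_numeral)
  then show "r = 81 * m^3 + 108 * m^2 * n + 24 * m * n^2"
    unfolding F using m by simp
qed

lemma nu_quartic:
  fixes q r m :: "'a::field_char_0"
  assumes F: "m^4 + (2/9) * q * m^2 + (8/81) * r * m - q^2 / 243 = 0"
    and m: "m \<noteq> 0" and q: "q \<noteq> 0"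
  defines "n \<equiv> - (9/8) * m - 1 / (24 * m) * q"
  shows "n^4 + r / q * n^3 - (3/64) * q^2 - (9/64) * (r^2 / q) = 0"
proof -
  note qr = mu_nu_parametrisation[OF F m, folded n_def]
  have "q * n^4 + r * n^3 - (3/64) * q^3 - (9/64) * r^2 = 0"
    unfolding qr by (simp add: field_simps eval_nat_numeral)
  moreover have "n^4 + r / q * n^3 - (3/64) * q^2 - (9/64) * (r^2 / q) =
      (q * n^4 + r * n^3 - (3/64) * q^3 - (9/64) * r^2) / q"
    using q by (simp add: field_simps eval_nat_numeral)
  ultimately show ?thesis by simp
qed

lemma nu_derivative:
  fixes P Q R :: "'a::real_normed_field \<Rightarrow> 'a"
  assumes sys: "chazy_system 3 S P Q R" and U: "open U" "U \<subseteq> S" and mu: "mu_branch U Q R \<mu>"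
    and x: "x \<in> U" "\<mu> x \<noteq> 0"
  defines "\<nu> \<equiv> \<lambda>x. - (9/8) * \<mu> x - 1 / (24 * \<mu> x) * Q x"
  shows "(\<nu> has_field_derivative P x * \<nu> x / 3 - \<mu> x * \<nu> x - 2/3 * (\<nu> x)^2) (at x)"
proof -
  have xS: "x \<in> S" using x U by auto
  have F: "(\<mu> x)^4 + (2/9) * Q x * (\<mu> x)^2 + (8/81) * R x * \<mu> x - (Q x)^2 / 243 = 0"
    using mu x by (auto simp: mu_branch_def)
  note [derivative_intros] = mu_branch_derivative[OF sys U mu x(1)] chazy_systemD(2)[OF sys xS]
  define n where "n = \<nu> x"
  note qr = mu_nu_parametrisation[OF F x(2)]
  have Q: "Q x = - 24 * \<mu> x * n - 27 * (\<mu> x)^2"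
    and R: "R x = 81 * (\<mu> x)^3 + 108 * (\<mu> x)^2 * n + 24 * \<mu> x * n^2"
    using qr by (simp_all add: n_def \<nu>_def)
  have "((\<lambda>x. - (9/8) * \<mu> x - (1/24) * (Q x / \<mu> x)) has_field_derivative
          P x * n / 3 - \<mu> x * n - 2/3 * n^2) (at x)"
    by (rule derivative_eq_intros x(2) refl)+
      (use x(2) in \<open>simp_all add: Q R field_simps eval_nat_numeral\<close>)
  then show ?thesis unfolding n_def[symmetric] unfolding \<nu>_def by simp
qed

lemma chazy_3_nu_transformation:
  fixes P Q R :: "'a::real_normed_field \<Rightarrow> 'a"
  assumes sys: "chazy_system 3 S P Q R" and U: "open U" "U \<subseteq> S" and mu: "mu_branch U Q R \<mu>"
  defines "\<nu> \<equiv> \<lambda>x. - (9/8) * \<mu> x - 1 / (24 * \<mu> x) * Q x"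
  shows "chazy_system 3 {x\<in>U. \<mu> x \<noteq> 0}
            (\<lambda>x. P x - \<nu> x)
            (\<lambda>x. (5/4) * Q x + (27/4) * (\<mu> x)^2 - 3 * (\<nu> x)^2)
            (\<lambda>x. (17/8) * R x - 3 * (\<nu> x)^3 + (63/16) * Q x * \<mu> x + (243/16) * (\<mu> x)^3)"
  unfolding chazy_system_def
proof (intro ballI)
  fix x assume "x \<in> {x\<in>U. \<mu> x \<noteq> 0}"
  then have x: "x \<in> U" "\<mu> x \<noteq> 0" by auto
  then have xS: "x \<in> S" using U by auto
  have d\<nu>: "(\<nu> has_field_derivative P x * \<nu> x / 3 - \<mu> x * \<nu> x - 2/3 * (\<nu> x)^2) (at x)"
    unfolding \<nu>_def by (rule nu_derivative[OF sys U mu x])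
  note [derivative_intros] = chazy_systemD(1,2)[OF sys xS] chazy_system_3D[OF sys xS]
    mu_branch_derivative[OF sys U mu x(1)] d\<nu>
  have F: "(\<mu> x)^4 + (2/9) * Q x * (\<mu> x)^2 + (8/81) * R x * \<mu> x - (Q x)^2 / 243 = 0"
    using mu x by (auto simp: mu_branch_def)
  have QR: "Q x = - 24 * \<mu> x * \<nu> x - 27 * (\<mu> x)^2"
    "R x = 81 * (\<mu> x)^3 + 108 * (\<mu> x)^2 * \<nu> x + 24 * \<mu> x * (\<nu> x)^2"
    using mu_nu_parametrisation[OF F x(2)] by (simp_all add: \<nu>_def)
  have k: "(3::'a)^2 / (36 - 3^2) = 1/3" by (simp add: power2_eq_square)
  show "((\<lambda>x. P x - \<nu> x) has_field_derivative
          (1/6) * ((P x - \<nu> x)^2 - ((5/4) * Q x + (27/4) * (\<mu> x)^2 - 3 * (\<nu> x)^2))) (at x) \<and>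
        ((\<lambda>x. (5/4) * Q x + (27/4) * (\<mu> x)^2 - 3 * (\<nu> x)^2) has_field_derivative
          (2/3) * ((P x - \<nu> x) * ((5/4) * Q x + (27/4) * (\<mu> x)^2 - 3 * (\<nu> x)^2)
            - ((17/8) * R x - 3 * (\<nu> x)^3 + (63/16) * Q x * \<mu> x + (243/16) * (\<mu> x)^3))) (at x) \<and>
        ((\<lambda>x. (17/8) * R x - 3 * (\<nu> x)^3 + (63/16) * Q x * \<mu> x + (243/16) * (\<mu> x)^3)
          has_field_derivative
          (P x - \<nu> x) * ((17/8) * R x - 3 * (\<nu> x)^3 + (63/16) * Q x * \<mu> x + (243/16) * (\<mu> x)^3)
            + 3^2 / (36 - 3^2) * ((5/4) * Q x + (27/4) * (\<mu> x)^2 - 3 * (\<nu> x)^2)^2) (at x)"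
    unfolding k
    by (intro conjI; (rule derivative_eq_intros refl)+)
      (simp_all add: QR field_simps eval_nat_numeral)
qed

theorem theorem4p1:
  fixes P Q R :: "'a::real_normed_field \<Rightarrow> 'a" and S :: "'a set"
  assumes "open S"
    and "chazy_system 3 S P Q R"
  shows
    "chazy_system 3 {x\<in>S. Q x \<noteq> 0}
       (\<lambda>x. P x + R x / Q x)
       (\<lambda>x. - Q x - 3 * ((R x)^2 / (Q x)^2))
       (\<lambda>x. R x + 3 * ((R x)^3 / (Q x)^3))
     \<and>
     (\<forall>U \<mu>. open U \<and> U \<subseteq> S \<and> mu_branch U Q R \<mu> \<longrightarrow>
       (let \<nu> = (\<lambda>x. - (9/8) * \<mu> x - 1 / (24 * \<mu> x) * Q x) in
          chazy_system 3 {x\<in>U. \<mu> x \<noteq> 0}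
            (\<lambda>x. P x - \<nu> x)
            (\<lambda>x. (5/4) * Q x + (27/4) * (\<mu> x)^2 - 3 * (\<nu> x)^2)
            (\<lambda>x. (17/8) * R x - 3 * (\<nu> x)^3 + (63/16) * Q x * \<mu> x + (243/16) * (\<mu> x)^3)
          \<and>
          (\<forall>x\<in>U. \<mu> x \<noteq> 0 \<and> Q x \<noteq> 0 \<longrightarrow>
            (\<nu> x)^4 + R x / Q x * (\<nu> x)^3 - (3/64) * (Q x)^2 - (9/64) * ((R x)^2 / Q x) = 0))
       \<and>
       chazy_system 2 U
         (\<lambda>x. P x + \<mu> x)
         (\<lambda>x. (4/3) * Q x + 4 * (\<mu> x)^2)
         (\<lambda>x. (4/3) * R x + 2 * Q x * \<mu> x + 10 * (\<mu> x)^3))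
     \<and>
     chazy_system 4 {x\<in>S. R x \<noteq> 0}
       (\<lambda>x. P x - (Q x)^2 / (3 * R x))
       (\<lambda>x. - (5/3) * Q x - (5/9) * ((Q x)^4 / (R x)^2))
       (\<lambda>x. - (5/3) * ((Q x)^3 / R x) - (5/3) * R x - (10/27) * ((Q x)^6 / (R x)^3))"
proof (intro conjI allI impI)
  fix U \<mu>
  assume asm: "open U \<and> U \<subseteq> S \<and> mu_branch U Q R \<mu>"
  then have U: "open U" "U \<subseteq> S" and mu: "mu_branch U Q R \<mu>" by auto
  have F: "(\<mu> x)^4 + (2/9) * Q x * (\<mu> x)^2 + (8/81) * R x * \<mu> x - (Q x)^2 / 243 = 0"
    if "x \<in> U" for x using mu that by (auto simp: mu_branch_def)
  show "let \<nu> = (\<lambda>x. - (9/8) * \<mu> x - 1 / (24 * \<mu> x) * Q x) in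
      chazy_system 3 {x\<in>U. \<mu> x \<noteq> 0}
        (\<lambda>x. P x - \<nu> x)
        (\<lambda>x. (5/4) * Q x + (27/4) * (\<mu> x)^2 - 3 * (\<nu> x)^2)
        (\<lambda>x. (17/8) * R x - 3 * (\<nu> x)^3 + (63/16) * Q x * \<mu> x + (243/16) * (\<mu> x)^3)
      \<and>
      (\<forall>x\<in>U. \<mu> x \<noteq> 0 \<and> Q x \<noteq> 0 \<longrightarrow>
        (\<nu> x)^4 + R x / Q x * (\<nu> x)^3 - (3/64) * (Q x)^2 - (9/64) * ((R x)^2 / Q x) = 0)"
    unfolding Let_def
    using chazy_3_nu_transformation[OF assms(2) U mu] nu_quartic[OF F] by blast
qed (use chazy_3_ratio_transformation chazy_4_transformation chazy_2_transformation assms(2)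
    in blast)+

end
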